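(* Suppose $v<0.221075$ and let $\widehat{\mathbf U}=(\widehat{\mathcal E},\widehat{\mathcal F}_i)$ be realizable. Then the iterates $\mathbf M^{[k]}=(\mathcal J^{[k]},\mathcal H^{[k]}_i)$ generated by $$\mathcal J^{[k+1]}=\mathcal J^{[k]}-\frac{\lambda}{W}\big(W\mathcal J^{[k]}+v^i\mathcal H^{[k]}_i-\widehat{\mathcal E}\big),\qquad \mathcal H^{[k+1]}_j=\mathcal H^{[k]}_j-\frac{\lambda}{W}\big(W\mathcal H^{[k]}_j+v^i\mathcal K_{ij}(\mathbf M^{[k]})-\widehat{\mathcal F}_j\big),$$ with $\lambda=(1+v)^{-1}$ and $\mathbf M^{[0]}=\widehat{\mathbf U}/W$, converge to a unique solution, namely the unique realizable solution $\mathbf M=(\mathcal J,\mathcal H_i)$ of $$\widehat{\mathcal E}=W\mathcal J+v^i\mathcal H_i,\qquad \widehat{\mathcal F}_j=W\mathcal H_j+v^i\mathcal K_{ij}(\mathbf M).$$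
   Context: $v^i\in\mathbb R^3$ is a three-velocity, $v=\sqrt{v_iv^i}$, $W=(1-v^2)^{-1/2}$, Latin indices $1..3$ raised/lowered with $\delta_{ij}$. Pairs $(\mathcal J,\mathcal H_i)$ and $(\widehat{\mathcal E},\widehat{\mathcal F}_i)$ represent a scalar and a covector orthogonal to $u^\mu=W(1,v^i)$ (time component $b_0=-v^ib_i$, metric $\mathrm{diag}(-1,1,1,1)$); a pair $(a,b_i)$ is realizable if $a>0$ and $a\ge\sqrt{b_ib^i-(v^ib_i)^2}$. Closure: with $\mathcal H=\sqrt{\mathcal H_i\mathcal H^i-(v^i\mathcal H_i)^2}$, $\mathsf h=\mathcal H/\mathcal J\in[0,1]$, $\widehat{\mathsf h}_i=\mathcal H_i/\mathcal H$, $h_{ij}=\delta_{ij}+W^2v_iv_j$, $$\mathcal K_{ij}(\mathbf M)=\tfrac12\big[(1-\mathsf k)h_{ij}+(3\mathsf k-1)\widehat{\mathsf h}_i\widehat{\mathsf h}_j\big]\mathcal J,\qquad \mathsf k(\mathsf h)=\tfrac13+\tfrac2{15}(3\mathsf h^2-\mathsf h^3+3\mathsf h^4)$$ (the $\widehat{\mathsf h}_i\widehat{\mathsf h}_j$ term is $0$ when $\mathcal H=0$, since then $3\mathsf k-1=0$). *)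

theory Defs
  imports "HOL-Analysis.Analysis"
begin

text \<open>
  Spatial indices are raised and lowered with the Kronecker delta, so three-vectors and the
  spatial parts of covectors are both rendered as \<^typ>\<open>real^3\<close>. A covector orthogonal to the
  four-velocity is represented by its spatial part \<open>b\<close>; its time component is \<open>- (v \<bullet> b)\<close>.
\<close>

definition lorentz :: "real^3 \<Rightarrow> real" where
  "lorentz v = 1 / sqrt (1 - (norm v)\<^sup>2)"

text \<open>The Minkowski length of the covector represented by \<open>b\<close>.\<close>

definition cov_norm :: "real^3 \<Rightarrow> real^3 \<Rightarrow> real" where
  "cov_norm v b = sqrt (b \<bullet> b - (v \<bullet> b)\<^sup>2)"

definition realizable :: "real^3 \<Rightarrow> real \<Rightarrow> real^3 \<Rightarrow> bool" where
  "realizable v a b \<longleftrightarrow> a > 0 \<and> a \<ge> cov_norm v b"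

definition eddington :: "real \<Rightarrow> real" where
  "eddington h = 1/3 + 2/15 * (3 * h^2 - h^3 + 3 * h^4)"

definition flux_factor :: "real^3 \<Rightarrow> real \<Rightarrow> real^3 \<Rightarrow> real" where
  "flux_factor v J H = cov_norm v H / J"

text \<open>
  If \<open>cov_norm v H = 0\<close> then division by zero makes this the zero vector; this yields the
  convention that the \<open>flux_dir\<close> term of the closure vanishes in that case.
\<close>

definition flux_dir :: "real^3 \<Rightarrow> real^3 \<Rightarrow> real^3" where
  "flux_dir v H = H /\<^sub>R cov_norm v H"

definition proj :: "real^3 \<Rightarrow> real^3^3" where
  "proj v = (\<chi> i j. (if i = j then 1 else 0) + (lorentz v)\<^sup>2 * v $ i * v $ j)"

definition closureK :: "real^3 \<Rightarrow> real \<Rightarrow> real^3 \<Rightarrow> real^3^3" where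
  "closureK v J H = (\<chi> i j. (let k = eddington (flux_factor v J H) in
      1/2 * ((1 - k) * proj v $ i $ j
             + (3 * k - 1) * (flux_dir v H $ i) * (flux_dir v H $ j)) * J))"

definition solves :: "real^3 \<Rightarrow> real \<Rightarrow> real^3 \<Rightarrow> real \<Rightarrow> real^3 \<Rightarrow> bool" where
  "solves v E F J H \<longleftrightarrow>
     E = lorentz v * J + (\<Sum>i\<in>UNIV. v $ i * H $ i) \<and>
     (\<forall>j. F $ j = lorentz v * H $ j + (\<Sum>i\<in>UNIV. v $ i * closureK v J H $ i $ j))"

end

theory Submission
  imports Defs
begin

text \<open>
  Stretching covectors by \<open>1/W\<close> along the velocity turns the Minkowski length into the Euclidean
  norm. In these coordinates, with \<open>v = s e\<close> and \<open>e\<close> a unit vector, the iteration reads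
  \<open>x \<mapsto> (s (x - G x) + b) / (1 + s)\<close> on \<open>\<real> \<times> \<real>^3\<close>, where \<open>G (J, y) = (y \<bullet> e, J \<Phi>(y/J))\<close> and \<open>\<Phi>\<close> is
  the Eddington tensor contracted with \<open>e\<close>. Since \<open>h\<^sup>2 \<le> k \<le> 1\<close>, the map \<open>x \<mapsto> x - G x\<close> preserves
  the cone \<open>norm y \<le> J\<close>; since \<open>\<Phi>\<close> is bounded by \<open>1\<close> and \<open>10/3\<close>-Lipschitz on the unit ball, \<open>G\<close> is
  \<open>13/3\<close>-Lipschitz for the norm \<open>\<bar>J\<bar> + norm y\<close>. As \<open>13/3 * s < 1\<close>, the iteration is a contraction
  on the part of the cone where \<open>J \<ge> fst b / (1 + s) > 0\<close>, which contains all realizable fixed points.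
\<close>

section \<open>Polynomial bounds on the Eddington factor\<close>

definition closure_poly :: "real \<Rightarrow> real" where
  "closure_poly h = 3 - h + 3 * h\<^sup>2"

text \<open>The trace-free part of the dyad of \<open>u\<close> with itself, contracted with
  \<open>e\<close>; the factor \<open>1/3\<close> is that of three dimensions, although the type is
  arbitrary.\<close>

definition traceless :: "'a::real_inner \<Rightarrow> 'a \<Rightarrow> 'a" where
  "traceless e u = (u \<bullet> e) *\<^sub>R u - ((norm u)\<^sup>2 / 3) *\<^sub>R e"

text \<open>
  The Eddington tensor \<open>K/J\<close> applied to \<open>e\<close>. Because \<open>3 k - 1\<close> is \<open>2/5 h\<^sup>2\<close> times a polynomial in \<open>h\<close>,
  the unit vector along \<open>u\<close>, singular at \<open>u = 0\<close>, does not occur.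
\<close>

definition pressure :: "'a::real_inner \<Rightarrow> 'a \<Rightarrow> 'a" where
  "pressure e u = (1/3) *\<^sub>R e + (closure_poly (norm u) / 5) *\<^sub>R traceless e u"

lemma eddington_closure_poly: "eddington h = 1/3 + 2/15 * (h\<^sup>2 * closure_poly h)"
  by (simp add: eddington_def closure_poly_def power2_eq_square power3_eq_cube power4_eq_xxxx algebra_simps)

lemma closure_poly_bounds:
  assumes "0 \<le> h" "h \<le> 1"
  shows "0 \<le> closure_poly h" "closure_poly h \<le> 5"
proof -
  have "h\<^sup>2 \<le> h"
    using assms by (simp add: power2_eq_square mult_left_le)
  then show "closure_poly h \<le> 5"
    using assms by (simp add: closure_poly_def)
  show "0 \<le> closure_poly h"
    using assms by (simp add: closure_poly_def add_nonneg_nonneg)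
qed

lemma closure_poly_lipschitz:
  assumes "0 \<le> h" "h \<le> 1" "0 \<le> k" "k \<le> 1"
  shows "\<bar>closure_poly h - closure_poly k\<bar> \<le> 5 * \<bar>h - k\<bar>"
proof -
  have "closure_poly h - closure_poly k = (3 * (h + k) - 1) * (h - k)"
    by (simp add: closure_poly_def power2_eq_square algebra_simps)
  moreover have "\<bar>3 * (h + k) - 1\<bar> \<le> 5"
    using assms by (simp add: abs_le_iff)
  ultimately show ?thesis
    by (metis abs_ge_zero abs_mult mult_right_mono)
qed

lemma eddington_le_1:
  assumes "0 \<le> h" "h \<le> 1"
  shows "eddington h \<le> 1"
proof -
  have "h\<^sup>2 * closure_poly h \<le> 1 * 5"
    using assms closure_poly_bounds[of h] by (intro mult_mono) (simp_all add: power_le_one)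
  then show ?thesis
    by (simp add: eddington_closure_poly)
qed

text \<open>Both sides agree to first order at \<open>h = 1\<close>, so \<open>(1 - h)^2\<close>
  splits off from the difference; the cofactor has positive coefficients.\<close>

lemma eddington_ge_square:
  assumes "0 \<le> h"
  shows "h\<^sup>2 \<le> eddington h"
proof -
  have "15 * (eddington h - h\<^sup>2) = (1 - h)\<^sup>2 * (5 + 10 * h + 6 * h\<^sup>2)"
    by (simp add: eddington_def power2_eq_square power3_eq_cube power4_eq_xxxx algebra_simps)
  moreover have "0 \<le> (1 - h)\<^sup>2 * (5 + 10 * h + 6 * h\<^sup>2)"
    using assms by simp
  ultimately show ?thesis
    by simp
qed

section \<open>The Eddington tensor contracted with a unit vector\<close>

context
  fixes e :: "'a::real_inner"
  assumes e: "norm e = 1"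
begin

lemma abs_inner_unit_le: "\<bar>u \<bullet> e\<bar> \<le> norm u"
  using Cauchy_Schwarz_ineq2[of u e] e by simp

lemma norm_traceless_le: "norm (traceless e u) \<le> 2/3 * (norm u)\<^sup>2"
proof (rule power2_le_imp_le)
  have "(u \<bullet> e)\<^sup>2 \<le> (norm u)\<^sup>2"
    using abs_inner_unit_le[of u] by (simp add: abs_le_square_iff[symmetric])
  then have "(norm u)\<^sup>2 * (u \<bullet> e)\<^sup>2 \<le> (norm u)\<^sup>2 * (norm u)\<^sup>2"
    by (intro mult_left_mono) auto
  moreover have "(norm (traceless e u))\<^sup>2 = (norm u)\<^sup>2 * (u \<bullet> e)\<^sup>2 / 3 + ((norm u)\<^sup>2)\<^sup>2 / 9"
  proof -
    have "e \<bullet> e = 1" "u \<bullet> u = norm u * norm u"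
      using e by (simp_all add: norm_eq_1 norm_eq_sqrt_inner)
    then show ?thesis
      unfolding power2_norm_eq_inner[of "traceless e u"]
      by (simp add: traceless_def inner_diff_right inner_commute[of e u]
          power2_eq_square algebra_simps)
  qed
  ultimately show "(norm (traceless e u))\<^sup>2 \<le> (2/3 * (norm u)\<^sup>2)\<^sup>2"
    by (simp add: power2_eq_square)
qed simp

lemma traceless_lipschitz:
  assumes "norm u \<le> 1" "norm w \<le> 1"
  shows "norm (traceless e u - traceless e w) \<le> 8/3 * norm (u - w)"
proof -
  \<comment> \<open>The two factors of the quadratic term contribute \<open>1\<close> each and the
    trace term \<open>2/3\<close>, in total \<open>8/3\<close>.\<close>
  have "traceless e u - traceless e w
      = (u \<bullet> e) *\<^sub>R (u - w) + ((u - w) \<bullet> e) *\<^sub>R w - (((norm u)\<^sup>2 - (norm w)\<^sup>2) / 3) *\<^sub>R e"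
    by (simp add: traceless_def algebra_simps diff_divide_distrib inner_diff_left)
  also have "norm \<dots>
      \<le> norm ((u \<bullet> e) *\<^sub>R (u - w)) + norm (((u - w) \<bullet> e) *\<^sub>R w)
        + norm ((((norm u)\<^sup>2 - (norm w)\<^sup>2) / 3) *\<^sub>R e)"
    by (intro order_trans[OF norm_triangle_ineq4] add_mono norm_triangle_ineq order_refl)
  also have "\<dots> = \<bar>u \<bullet> e\<bar> * norm (u - w) + \<bar>(u - w) \<bullet> e\<bar> * norm w + \<bar>(norm u)\<^sup>2 - (norm w)\<^sup>2\<bar> / 3"
    by (simp add: e)
  also have "\<bar>u \<bullet> e\<bar> * norm (u - w) \<le> 1 * norm (u - w)"
    using abs_inner_unit_le[of u] assms by (intro mult_right_mono) auto
  also have "\<bar>(u - w) \<bullet> e\<bar> * norm w \<le> norm (u - w) * 1"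
    using abs_inner_unit_le[of "u - w"] assms by (intro mult_mono) auto
  also have "\<bar>(norm u)\<^sup>2 - (norm w)\<^sup>2\<bar> \<le> 2 * norm (u - w)"
  proof -
    have "\<bar>(norm u)\<^sup>2 - (norm w)\<^sup>2\<bar> = (norm u + norm w) * \<bar>norm u - norm w\<bar>"
      by (simp add: power2_eq_square square_diff_square_factored abs_mult)
    also have "\<dots> \<le> 2 * norm (u - w)"
      using assms norm_triangle_ineq3[of u w] by (intro mult_mono) auto
    finally show ?thesis .
  qed
  finally show ?thesis
    by simp
qed

lemma norm_pressure_le:
  assumes "norm u \<le> 1"
  shows "norm (pressure e u) \<le> 1"
proof -
  have "norm (traceless e u) \<le> 2/3"
    using norm_traceless_le[of u] power_le_one[OF norm_ge_zero assms, of 2] by linarith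
  then have "closure_poly (norm u) / 5 * norm (traceless e u) \<le> 1 * (2/3)"
    using closure_poly_bounds[of "norm u"] assms by (intro mult_mono) auto
  moreover have "norm (pressure e u) \<le> 1/3 + closure_poly (norm u) / 5 * norm (traceless e u)"
    unfolding pressure_def using closure_poly_bounds[of "norm u"] assms e
    by (intro norm_triangle_le) simp
  ultimately show ?thesis
    by simp
qed

lemma pressure_lipschitz:
  assumes u: "norm u \<le> 1" and w: "norm w \<le> 1"
  shows "norm (pressure e u - pressure e w) \<le> 10/3 * norm (u - w)"
proof -
  let ?p = "closure_poly (norm u)" and ?q = "closure_poly (norm w)"
  \<comment> \<open>Product rule: the bounds \<open>5 * 8/3\<close> and \<open>5 * 2/3\<close> add
    up to \<open>50/3\<close>, which is five times the claimed constant.\<close>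
  have "5 *\<^sub>R (pressure e u - pressure e w)
      = ?p *\<^sub>R (traceless e u - traceless e w) + (?p - ?q) *\<^sub>R traceless e w"
    by (simp add: pressure_def algebra_simps)
  then have "5 * norm (pressure e u - pressure e w)
      \<le> \<bar>?p\<bar> * norm (traceless e u - traceless e w) + \<bar>?p - ?q\<bar> * norm (traceless e w)"
    by (metis norm_scaleR norm_triangle_ineq abs_numeral)
  also have "\<bar>?p\<bar> * norm (traceless e u - traceless e w) \<le> 5 * (8/3 * norm (u - w))"
    using closure_poly_bounds[of "norm u"] u traceless_lipschitz[OF u w] by (intro mult_mono) auto
  also have "\<bar>?p - ?q\<bar> * norm (traceless e w) \<le> (5 * norm (u - w)) * (2/3)"
  proof (rule mult_mono)
    show "\<bar>?p - ?q\<bar> \<le> 5 * norm (u - w)"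
      using closure_poly_lipschitz[of "norm u" "norm w"] u w norm_triangle_ineq3[of u w] by simp
    show "norm (traceless e w) \<le> 2/3"
      using norm_traceless_le[of w] power_le_one[OF norm_ge_zero w, of 2] by linarith
  qed auto
  finally show ?thesis
    by simp
qed

text \<open>Cone invariance of \<open>x - G x\<close>, normalised to \<open>J = 1\<close>. Both
  sides depend only on \<open>h = norm u\<close>, the Eddington factor \<open>k\<close> and the
  cosine between \<open>u\<close> and \<open>e\<close>; the inequality between them follows from
  \<open>h^2 \<le> k \<le> 1\<close>.\<close>

lemma pressure_cone:
  assumes u: "norm u \<le> 1"
  shows "norm (u - pressure e u) \<le> 1 - u \<bullet> e"
proof (cases "u = 0")
  case True
  then show ?thesis
    using e by (simp add: pressure_def traceless_def)
next
  case False
  define h where "h = norm u"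
  define k where "k = eddington h"
  define x where "x = (u \<bullet> e) / h"
  \<comment> \<open>The Eddington tensor has eigenvalue \<open>k\<close> along \<open>u\<close> and
    \<open>\<alpha>\<close> across it; \<open>\<beta>\<close> is
    \<open>(3 * k - 1) / (2 * h^2)\<close>.\<close>
  define \<alpha> where "\<alpha> = (1 - k) / 2"
  define \<beta> where "\<beta> = closure_poly h / 5"
  have h: "0 < h" "h \<le> 1"
    using False u by (auto simp: h_def)
  have ue: "u \<bullet> e = h * x"
    using h by (simp add: x_def)
  have "\<bar>x\<bar> \<le> 1"
    using abs_inner_unit_le[of u] h by (simp add: x_def h_def)
  then have x2: "x\<^sup>2 \<le> 1"
    by (simp add: abs_square_le_1)
  have k: "h\<^sup>2 \<le> k" "k \<le> 1"
    using h by (simp_all add: k_def eddington_ge_square eddington_le_1)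
  have k_eq: "k = \<alpha> + \<beta> * h\<^sup>2"
    by (simp add: k_def \<alpha>_def \<beta>_def eddington_closure_poly field_simps)
  have "pressure e u = \<alpha> *\<^sub>R e + (\<beta> * (u \<bullet> e)) *\<^sub>R u"
  proof -
    have "1/3 = \<alpha> + \<beta> * h\<^sup>2 / 3"
      by (simp add: k_def \<alpha>_def \<beta>_def eddington_closure_poly field_simps)
    then have "(1/3) *\<^sub>R e = \<alpha> *\<^sub>R e + (\<beta> * h\<^sup>2 / 3) *\<^sub>R e"
      by (metis scaleR_add_left)
    then show ?thesis
      by (simp add: pressure_def traceless_def h_def[symmetric] \<beta>_def[symmetric] algebra_simps)
  qed
  then have u_diff: "u - pressure e u = (1 - \<beta> * (h * x)) *\<^sub>R u - \<alpha> *\<^sub>R e"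
    by (simp add: ue algebra_simps)
  have "u \<bullet> u = h\<^sup>2" "e \<bullet> e = 1"
    using e by (simp_all add: h_def power2_norm_eq_inner norm_eq_1)
  then have "(norm (u - pressure e u))\<^sup>2
      = (1 - \<beta> * (h * x))\<^sup>2 * h\<^sup>2 - 2 * \<alpha> * (1 - \<beta> * (h * x)) * (h * x) + \<alpha>\<^sup>2"
    unfolding power2_norm_eq_inner u_diff
    by (simp add: inner_diff_right inner_commute[of e u] ue power2_eq_square algebra_simps)
  \<comment> \<open>Pythagoras: \<open>h - k * x\<close> is the component along \<open>u\<close>,
    and the other summand is the square of the component across it.\<close>
  also have "\<dots> = (h - k * x)\<^sup>2 + \<alpha>\<^sup>2 * (1 - x\<^sup>2)"
    unfolding k_eq by (simp add: power2_eq_square algebra_simps)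
  \<comment> \<open>\<open>x\<close> is the cosine of the angle between \<open>u\<close> and \<open>e\<close>; the margin comes from the reverse
    Cauchy-Schwarz inequality \<open>(1 - h x)\<^sup>2 \<ge> (1 - h\<^sup>2) (1 - x\<^sup>2)\<close>.\<close>
  also have "\<dots> \<le> (1 - h * x)\<^sup>2"
  proof -
    have "(1 - k) * (1 - x\<^sup>2) \<le> (1 - h\<^sup>2) * (1 - x\<^sup>2)"
      using k x2 by (intro mult_right_mono) auto
    also have "\<dots> = (1 - h * x)\<^sup>2 - (h - x)\<^sup>2"
      by (simp add: power2_eq_square algebra_simps)
    finally have "(1 - k) * (1 - x\<^sup>2) \<le> (1 - h * x)\<^sup>2"
      by (smt (verit) zero_le_power2)
    moreover have "0 \<le> (1 - k) * (1 - x\<^sup>2)" "0 \<le> (k - h\<^sup>2) * x\<^sup>2" "0 \<le> (k - h\<^sup>2) * (1 - x\<^sup>2)"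
      using k x2 by simp_all
    \<comment> \<open>For \<open>k = 1\<close> the margin is \<open>(1 - h^2) * (1 - x^2)\<close>,
      the value of the last summand there; what remains for general \<open>k\<close> contains the
      factor \<open>1 - k\<close>.\<close>
    ultimately have "0 \<le> (1 - k) * ((1 - h * x)\<^sup>2 + (k - h\<^sup>2) * x\<^sup>2 - (1 - k) * (1 - x\<^sup>2) / 4)
        + (k - h\<^sup>2) * (1 - x\<^sup>2)"
      using k by (intro add_nonneg_nonneg mult_nonneg_nonneg[of "1 - k"]) linarith+
    also have "\<dots> = (1 - h * x)\<^sup>2 - ((h - k * x)\<^sup>2 + \<alpha>\<^sup>2 * (1 - x\<^sup>2))"
      by (simp add: \<alpha>_def power2_eq_square field_simps)
    finally show ?thesis
      by simp
  qed
  finally have "(norm (u - pressure e u))\<^sup>2 \<le> (1 - u \<bullet> e)\<^sup>2"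
    by (simp add: ue)
  moreover have "0 \<le> 1 - u \<bullet> e"
    using abs_inner_unit_le[of u] u by linarith
  ultimately show ?thesis
    by (rule power2_le_imp_le)
qed


lemma cone_pressure:
  assumes "0 < J" "norm y \<le> J"
  shows "norm (y - J *\<^sub>R pressure e (y /\<^sub>R J)) \<le> J - y \<bullet> e"
proof -
  have "norm (y /\<^sub>R J - pressure e (y /\<^sub>R J)) \<le> 1 - (y /\<^sub>R J) \<bullet> e"
    using assms by (intro pressure_cone) (simp add: field_simps)
  then have "J * norm (y /\<^sub>R J - pressure e (y /\<^sub>R J)) \<le> J * (1 - (y /\<^sub>R J) \<bullet> e)"
    using assms by (intro mult_left_mono) auto
  also have "J * norm (y /\<^sub>R J - pressure e (y /\<^sub>R J)) = norm (J *\<^sub>R (y /\<^sub>R J - pressure e (y /\<^sub>R J)))"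
    using assms by simp
  finally show ?thesis
    using assms by (simp add: scaleR_diff_right right_diff_distrib mult.assoc[symmetric])
qed

text \<open>The factor \<open>J\<close> undoes the division by \<open>J\<close>, so the constants do
  not degenerate as \<open>J\<close> tends to \<open>0\<close>. The constant \<open>13/3\<close> is
  \<open>10/3\<close> from the Lipschitz bound plus \<open>1\<close> from the bound on
  \<open>pressure\<close> itself.\<close>

lemma scaled_pressure_lipschitz:
  assumes J: "0 < J" "norm y \<le> J" and J': "0 < J'" "norm y' \<le> J'"
  shows "norm (J *\<^sub>R pressure e (y /\<^sub>R J) - J' *\<^sub>R pressure e (y' /\<^sub>R J'))
    \<le> 10/3 * norm (y - y') + 13/3 * \<bar>J - J'\<bar>"
proof -
  define u u' where "u = y /\<^sub>R J" and "u' = y' /\<^sub>R J'"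
  have n: "norm u \<le> 1" "norm u' \<le> 1"
    using assms by (simp_all add: u_def u'_def field_simps)
  have y: "y = J *\<^sub>R u" "y' = J' *\<^sub>R u'"
    using assms by (simp_all add: u_def u'_def)
  have "J * norm (u - u') = norm (J *\<^sub>R (u - u'))"
    using J by simp
  also have "J *\<^sub>R (u - u') = (y - y') - (J - J') *\<^sub>R u'"
    by (simp add: y algebra_simps)
  also have "norm \<dots> \<le> norm (y - y') + \<bar>J - J'\<bar> * norm u'"
    by (metis norm_triangle_ineq4 norm_scaleR)
  also have "\<dots> \<le> norm (y - y') + \<bar>J - J'\<bar>"
    using n by (simp add: mult_left_le)
  finally have Ju: "J * norm (u - u') \<le> norm (y - y') + \<bar>J - J'\<bar>" .
  have "J *\<^sub>R pressure e u - J' *\<^sub>R pressure e u'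
      = J *\<^sub>R (pressure e u - pressure e u') + (J - J') *\<^sub>R pressure e u'"
    by (simp add: algebra_simps)
  then have "norm (J *\<^sub>R pressure e u - J' *\<^sub>R pressure e u')
      \<le> J * norm (pressure e u - pressure e u') + \<bar>J - J'\<bar> * norm (pressure e u')"
    using J by (metis norm_triangle_ineq norm_scaleR abs_of_pos)
  also have "\<dots> \<le> J * (10/3 * norm (u - u')) + \<bar>J - J'\<bar> * 1"
    using J n by (intro add_mono mult_left_mono pressure_lipschitz norm_pressure_le) auto
  also have "\<dots> \<le> 10/3 * norm (y - y') + 13/3 * \<bar>J - J'\<bar>"
    using Ju by simp
  finally show ?thesis
    by (simp add: u_def u'_def)
qed

end

section \<open>The iteration as a contraction of a cone\<close>

definition moment_step :: "'a::real_inner \<Rightarrow> real \<Rightarrow> real \<times> 'a \<Rightarrow> real \<times> 'a \<Rightarrow> real \<times> 'a" where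
  "moment_step e s b x = (1 / (1 + s)) *\<^sub>R
     (s *\<^sub>R (x - (snd x \<bullet> e, fst x *\<^sub>R pressure e (snd x /\<^sub>R fst x))) + b)"

definition taxicab :: "real \<times> 'a::real_normed_vector \<Rightarrow> real" where
  "taxicab z = \<bar>fst z\<bar> + norm (snd z)"

text \<open>The condition \<open>fst x > 0\<close> is not closed; a positive \<open>m\<close> gives
  a closed set on which it still holds, as the limit argument requires.\<close>

definition truncated_cone :: "real \<Rightarrow> (real \<times> 'a::real_normed_vector) set" where
  "truncated_cone m = {x. m \<le> fst x \<and> norm (snd x) \<le> fst x}"

lemma closed_truncated_cone: "closed (truncated_cone m)"
  unfolding truncated_cone_def
  by (intro closed_Collect_conj closed_Collect_le continuous_intros)

text \<open>The first component of \<open>x - G x\<close> is nonnegative on the cone, so a step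
  keeps at least \<open>fst b / (1 + s)\<close>. Since \<open>x\<close> is only assumed to have
  positive \<open>fst x\<close>, every fixed point in the cone is caught by the truncated
  one.\<close>

lemma moment_step_in_cone:
  assumes e: "norm e = 1" and s: "0 \<le> s" and b: "norm (snd b) \<le> fst b"
    and x: "0 < fst x" "norm (snd x) \<le> fst x"
  shows "moment_step e s b x \<in> truncated_cone (fst b / (1 + s))"
proof -
  let ?J = "fst x" and ?y = "snd x"
  let ?z = "?y - ?J *\<^sub>R pressure e (?y /\<^sub>R ?J)"
  have z: "norm ?z \<le> ?J - ?y \<bullet> e"
    by (rule cone_pressure[OF e x])
  then have "0 \<le> ?J - ?y \<bullet> e"
    using norm_ge_zero order_trans by blast
  then have "fst b \<le> s * (?J - ?y \<bullet> e) + fst b"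
    using s by simp
  moreover have "norm (s *\<^sub>R ?z + snd b) \<le> s * (?J - ?y \<bullet> e) + fst b"
    using s b z by (intro norm_triangle_le add_mono) (simp_all add: mult_left_mono)
  ultimately show ?thesis
    using s by (simp add: moment_step_def truncated_cone_def divide_right_mono)
qed

lemma moment_step_contraction:
  assumes e: "norm e = 1" and s: "0 \<le> s"
    and x: "0 < fst x" "norm (snd x) \<le> fst x" and x': "0 < fst x'" "norm (snd x') \<le> fst x'"
  shows "taxicab (moment_step e s b x - moment_step e s b x') \<le> 16/3 * s / (1 + s) * taxicab (x - x')"
proof -
  let ?g = "\<lambda>x. (snd x \<bullet> e, fst x *\<^sub>R pressure e (snd x /\<^sub>R fst x))"
  have "\<bar>(snd x - snd x') \<bullet> e\<bar> \<le> norm (snd x - snd x')"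
    by (rule abs_inner_unit_le[OF e])
  \<comment> \<open>The first component of \<open>G\<close> adds \<open>1\<close> to the constant
    \<open>10/3\<close> of \<open>y\<close>, which then equals the constant \<open>13/3\<close> of
    \<open>J\<close>.\<close>
  then have "taxicab (?g x - ?g x') \<le> 13/3 * taxicab (x - x')"
    using scaled_pressure_lipschitz[OF e x x'] by (simp add: taxicab_def inner_diff_left)
  moreover have "taxicab ((x - x') - (?g x - ?g x')) \<le> taxicab (x - x') + taxicab (?g x - ?g x')"
    unfolding taxicab_def fst_diff snd_diff
    using abs_triangle_ineq4 norm_triangle_ineq4 by (smt (verit))
  ultimately have t: "taxicab ((x - x') - (?g x - ?g x')) \<le> 16/3 * taxicab (x - x')"
    by simp
  have "moment_step e s b x - moment_step e s b x' = (s / (1 + s)) *\<^sub>R ((x - x') - (?g x - ?g x'))"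
    unfolding moment_step_def scaleR_diff_right[symmetric] by (simp add: scaleR_diff_right algebra_simps)
  then have "taxicab (moment_step e s b x - moment_step e s b x')
      = s / (1 + s) * taxicab ((x - x') - (?g x - ?g x'))"
    using s by (simp only: taxicab_def fst_scaleR snd_scaleR norm_scaleR real_scaleR_def abs_mult)
      (simp add: distrib_left)
  also have "\<dots> \<le> s / (1 + s) * (16/3 * taxicab (x - x'))"
    using s t by (intro mult_left_mono) auto
  finally show ?thesis
    by (simp add: mult_ac)
qed

text \<open>Banach's fixed point principle with the contraction measured by \<open>g\<close>, which
  is comparable to the norm. The recursion is assumed only on \<open>S\<close>, because the scheme
  takes the form \<open>f\<close> only there.\<close>

lemma contraction_iterates_converge:
  fixes f :: "'b::banach \<Rightarrow> 'b"
  assumes S: "closed S" "\<And>z. z \<in> S \<Longrightarrow> f z \<in> S"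
    and x: "x 0 \<in> S" "\<And>n. x n \<in> S \<Longrightarrow> x (Suc n) = f (x n)"
    and c: "0 \<le> c" "c < 1"
    and contr: "\<And>z w. z \<in> S \<Longrightarrow> w \<in> S \<Longrightarrow> g (f z - f w) \<le> c * g (z - w)"
    and g: "\<And>z. norm z \<le> g z" "\<And>z. g z \<le> C * norm z"
  obtains p where "p \<in> S" "f p = p" "x \<longlonglongrightarrow> p" "\<And>q. q \<in> S \<Longrightarrow> f q = q \<Longrightarrow> q = p"
proof -
  have xS: "x n \<in> S" for n
    by (induction n) (use S x in auto)
  then have xf: "x (Suc n) = f (x n)" for n
    using x by blast
  have "g (x (Suc n) - x n) \<le> c ^ n * g (x 1 - x 0)" for n
  proof (induction n)
    case (Suc n)
    have "g (x (Suc (Suc n)) - x (Suc n)) \<le> c * g (x (Suc n) - x n)"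
      using contr[OF xS[of "Suc n"] xS[of n]] by (simp only: xf)
    also have "\<dots> \<le> c * (c ^ n * g (x 1 - x 0))"
      using Suc c by (intro mult_left_mono)
    finally show ?case
      by simp
  qed simp
  then have increment: "norm (x (Suc n) - x n) \<le> c ^ n * g (x 1 - x 0)" for n
    using g(1) order_trans by blast
  \<comment> \<open>The increments have a geometric majorant, and their partial sums telescope to
    \<open>x n - x 0\<close>.\<close>
  have "summable (\<lambda>n. c ^ n * g (x 1 - x 0))"
    using c by (intro summable_mult2 summable_geometric) simp
  then have "summable (\<lambda>n. x (Suc n) - x n)"
    by (rule summable_comparison_test'[where N = 0]) (rule increment)
  then have "convergent (\<lambda>n. x n - x 0)"
    by (simp add: summable_iff_convergent sum_lessThan_telescope)
  then have "convergent (\<lambda>n. (x n - x 0) + x 0)"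
    by (intro convergent_add convergent_const)
  then obtain p where p: "x \<longlonglongrightarrow> p"
    by (auto simp: convergent_def)
  then have pS: "p \<in> S"
    using S(1) xS closed_sequentially by blast
  \<comment> \<open>The upper comparison \<open>g z \<le> C * norm z\<close> turns the contraction
    property into convergence in norm.\<close>
  have "(\<lambda>n. x (Suc n)) \<longlonglongrightarrow> f p"
  proof (rule LIM_zero_cancel, rule Lim_null_comparison)
    have "norm (x (Suc n) - f p) \<le> c * (C * norm (x n - p))" for n
      using g(1)[of "x (Suc n) - f p"] contr[OF xS[of n] pS] xf[of n]
        mult_left_mono[OF g(2)[of "x n - p"] c(1)] by simp
    then show "\<forall>\<^sub>F n in sequentially. norm (x (Suc n) - f p) \<le> c * (C * norm (x n - p))"
      by simp
    show "(\<lambda>n. c * (C * norm (x n - p))) \<longlonglongrightarrow> 0"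
      using p by (intro tendsto_mult_right_zero tendsto_norm_zero LIM_zero)
  qed
  then have fp: "f p = p"
    using LIMSEQ_Suc[OF p] LIMSEQ_unique by blast
  have "q = p" if "q \<in> S" "f q = q" for q
  proof -
    have "(1 - c) * g (q - p) \<le> 0"
      using contr[OF that(1) pS] that(2) fp by (simp add: algebra_simps)
    then have "g (q - p) \<le> 0"
      using c by (simp add: mult_le_0_iff)
    then have "norm (q - p) \<le> 0"
      using g(1) order_trans by blast
    then show ?thesis
      by simp
  qed
  then show ?thesis
    by (rule that[OF pS fp p])
qed

lemma moment_iterates_converge:
  fixes e :: "'a::{real_inner,banach}"
  assumes e: "norm e = 1" and s: "0 \<le> s" "s < 0.221075"
    and b: "0 < fst b" "norm (snd b) \<le> fst b"
    and x: "x 0 = b"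
      "\<And>n. 0 < fst (x n) \<Longrightarrow> norm (snd (x n)) \<le> fst (x n) \<Longrightarrow> x (Suc n) = moment_step e s b (x n)"
  obtains p where "0 < fst p" "norm (snd p) \<le> fst p" "moment_step e s b p = p" "x \<longlonglongrightarrow> p"
    "\<And>q. 0 < fst q \<Longrightarrow> norm (snd q) \<le> fst q \<Longrightarrow> moment_step e s b q = q \<Longrightarrow> q = p"
proof -
  let ?S = "truncated_cone (fst b / (1 + s)) :: (real \<times> 'a) set"
  have pos: "0 < fst z" "norm (snd z) \<le> fst z" if "z \<in> ?S" for z
    using that b s by (auto simp: truncated_cone_def intro: less_le_trans[of 0 "fst b / (1 + s)"])
  have "fst b / (1 + s) \<le> fst b"
    using b s by (simp add: field_simps)
  then have x0: "x 0 \<in> ?S"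
    using b x by (simp add: truncated_cone_def)
  \<comment> \<open>The factor is below \<open>1\<close> exactly when \<open>s < 3/13\<close>, about
    \<open>0.2308\<close>.\<close>
  have "0 \<le> 16/3 * s / (1 + s)" "16/3 * s / (1 + s) < 1"
    using s by (simp_all add: field_simps)
  moreover have "norm z \<le> taxicab z" for z :: "real \<times> 'a"
    unfolding taxicab_def using norm_Pair_le[of "fst z" "snd z"] by simp
  moreover have "taxicab z \<le> 2 * norm z" for z :: "real \<times> 'a"
    unfolding taxicab_def using norm_fst_le[of "fst z" "snd z"] norm_snd_le[of "snd z" "fst z"] by simp
  ultimately obtain p where p: "p \<in> ?S" "moment_step e s b p = p" "x \<longlonglongrightarrow> p"
    "\<And>q. q \<in> ?S \<Longrightarrow> moment_step e s b q = q \<Longrightarrow> q = p"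
    using contraction_iterates_converge[of ?S "moment_step e s b" x "16/3 * s / (1 + s)" taxicab 2]
      closed_truncated_cone moment_step_in_cone[OF e s(1) b(2)] moment_step_contraction[OF e s(1)]
      pos x0 x(2)
    by (smt (verit))
  \<comment> \<open>A fixed point in the cone is its own image and hence lies in the truncated cone,
    so uniqueness extends to all of them.\<close>
  show ?thesis
    using p moment_step_in_cone[OF e s(1) b(2)] pos that by metis
qed

section \<open>Comoving coordinates for covectors\<close>

text \<open>With \<open>r = 1/W\<close> this gives the spatial components in an orthonormal frame
  moving with the fluid: the boost, combined with \<open>b_0 = - (v \<bullet> b)\<close>, divides
  the component along the velocity by \<open>W\<close>.\<close>

definition stretch :: "'a::real_inner \<Rightarrow> real \<Rightarrow> 'a \<Rightarrow> 'a" where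
  "stretch e r b = b + ((r - 1) * (b \<bullet> e)) *\<^sub>R e"

lemma bounded_linear_stretch: "bounded_linear (stretch e r)"
  unfolding stretch_def
  by (intro bounded_linear_intros)

lemmas linear_stretch = bounded_linear.linear[OF bounded_linear_stretch]

lemma stretch_inner:
  assumes "norm e = 1"
  shows "stretch e r b \<bullet> e = r * (b \<bullet> e)"
  using assms by (simp add: stretch_def inner_add_left norm_eq_1 algebra_simps)

lemma stretch_inverse:
  assumes "norm e = 1" "r \<noteq> 0"
  shows "stretch e (1 / r) (stretch e r b) = b"
proof -
  have "stretch e (1 / r) (stretch e r b)
      = b + ((r - 1) * (b \<bullet> e) + (1 / r - 1) * (r * (b \<bullet> e))) *\<^sub>R e"
    by (simp add: stretch_def[of e "1 / r"] stretch_inner[OF assms(1)])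
      (simp add: stretch_def scaleR_add_left)
  also have "(r - 1) * (b \<bullet> e) + (1 / r - 1) * (r * (b \<bullet> e)) = 0"
    using assms(2) by (simp add: field_simps)
  finally show ?thesis
    by simp
qed

lemma norm_stretch:
  assumes "norm e = 1"
  shows "(norm (stretch e r b))\<^sup>2 = b \<bullet> b + (r\<^sup>2 - 1) * (b \<bullet> e)\<^sup>2"
proof -
  have "e \<bullet> e = 1"
    using assms by (simp add: norm_eq_1)
  then show ?thesis
    unfolding power2_norm_eq_inner
    by (simp add: stretch_def inner_add_left inner_add_right inner_commute[of e b]
        power2_eq_square algebra_simps)
qed

section \<open>The closure and the scheme in comoving coordinates\<close>

context
  fixes e v :: "real^3" and s r :: real
  assumes e: "norm e = 1" and v: "v = s *\<^sub>R e" and s: "0 \<le> s" "s < 1"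
    and r: "r = sqrt (1 - s\<^sup>2)"
begin

lemma r_pos: "0 < r" and r_square: "r\<^sup>2 = 1 - s\<^sup>2"
proof -
  have "s\<^sup>2 < 1"
    using s by (simp add: power2_eq_square mult_strict_mono[of s 1 s 1, simplified])
  then show "0 < r" "r\<^sup>2 = 1 - s\<^sup>2"
    by (simp_all add: r)
qed

lemma lorentz_eq: "lorentz v = 1 / r"
  using e s by (simp add: lorentz_def v r)

lemma cov_norm_eq: "cov_norm v b = norm (stretch e r b)"
proof -
  have "cov_norm v b = sqrt ((norm (stretch e r b))\<^sup>2)"
    unfolding norm_stretch[OF e] cov_norm_def
    by (simp add: v r_square inner_commute[of e b] power_mult_distrib)
  then show ?thesis
    by simp
qed

lemma inner_v: "v \<bullet> b = s / r * (stretch e r b \<bullet> e)"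
  unfolding stretch_inner[OF e] using r_pos by (simp add: v inner_commute[of e])

text \<open>The velocity is an eigenvector of \<open>proj v\<close> with eigenvalue
  \<open>1 + W^2 * s^2 = W^2\<close>.\<close>

lemma row_proj: "(\<Sum>i\<in>UNIV. v $ i * proj v $ i $ j) = v $ j / r\<^sup>2"
proof -
  have "v $ i * proj v $ i $ j = (if i = j then v $ i else 0) + (lorentz v)\<^sup>2 * v $ j * (v $ i * v $ i)" for i
    by (simp add: proj_def algebra_simps)
  then have "(\<Sum>i\<in>UNIV. v $ i * proj v $ i $ j) = v $ j + (lorentz v)\<^sup>2 * v $ j * (v \<bullet> v)"
    by (simp add: inner_vec_def sum_distrib_left sum.distrib)
  also have "v \<bullet> v = s\<^sup>2"
    using e by (simp add: v norm_eq_1 power2_eq_square)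
  also have "v $ j + (lorentz v)\<^sup>2 * v $ j * s\<^sup>2 = v $ j * (r\<^sup>2 + s\<^sup>2) / r\<^sup>2"
    using r_pos by (simp add: lorentz_eq field_simps)
  finally show ?thesis
    by (simp add: r_square)
qed

lemma stretch_closure:
  assumes J: "0 < J"
  shows "stretch e r (\<chi> j. \<Sum>i\<in>UNIV. v $ i * closureK v J H $ i $ j)
    = (s / r) *\<^sub>R J *\<^sub>R pressure e (stretch e r H /\<^sub>R J)" (is "stretch e r ?w = _")
proof -
  let ?T = "stretch e r"
  interpret T: linear ?T
    by (rule linear_stretch)
  define y u k where "y = ?T H" and "u = y /\<^sub>R J" and "k = eddington (norm u)"
  have flux: "flux_factor v J H = norm u" "flux_dir v H = H /\<^sub>R norm y"
    using J by (simp_all add: flux_factor_def flux_dir_def cov_norm_eq y_def u_def field_simps)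
  have "(\<Sum>i\<in>UNIV. v $ i * closureK v J H $ i $ j)
      = J / 2 * ((1 - k) * (\<Sum>i\<in>UNIV. v $ i * proj v $ i $ j)
          + (3 * k - 1) * (v \<bullet> flux_dir v H) * flux_dir v H $ j)" for j
    by (simp add: closureK_def flux(1) k_def[symmetric] Let_def inner_vec_def sum_distrib_left
        sum_distrib_right sum.distrib[symmetric])
      (rule sum.cong, auto simp: field_simps)
  then have w: "?w = (J / 2) *\<^sub>R (((1 - k) / r\<^sup>2) *\<^sub>R v
      + ((3 * k - 1) * (v \<bullet> flux_dir v H)) *\<^sub>R flux_dir v H)"
    by (simp add: vec_eq_iff row_proj)
  have "?T v = (r * s) *\<^sub>R e"
    using e by (simp add: stretch_def v norm_eq_1 algebra_simps)
  moreover have "v \<bullet> flux_dir v H = s / r * (y \<bullet> e) / norm y"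
    by (simp add: flux(2) inner_v y_def divide_inverse)
  moreover have "?T (flux_dir v H) = y /\<^sub>R norm y"
    by (simp add: flux(2) T.scale y_def)
  ultimately have "?T ?w = (J / 2) *\<^sub>R (((1 - k) * s / r) *\<^sub>R e
      + ((3 * k - 1) * (s / r * (y \<bullet> e) / norm y)) *\<^sub>R (y /\<^sub>R norm y))"
    using r_pos by (simp only: w T.scale T.add) (simp add: power2_eq_square)
  also have "\<dots> = (s / r * J) *\<^sub>R (((1 - k) / 2) *\<^sub>R e
      + ((3 * k - 1) / 2 * (y \<bullet> e) / (norm y)\<^sup>2) *\<^sub>R y)"
    by (simp add: scaleR_add_right power2_eq_square field_simps)
  also have "((3 * k - 1) / 2 * (y \<bullet> e) / (norm y)\<^sup>2) *\<^sub>R y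
      = (closure_poly (norm u) / 5 * (u \<bullet> e)) *\<^sub>R u"
    \<comment> \<open>For \<open>y = 0\<close> both sides vanish, division by zero being zero;
      otherwise the factor \<open>(norm u)^2\<close> of \<open>3 * k - 1\<close> cancels the
      denominator.\<close>
    using J by (cases "y = 0") (simp_all add: u_def k_def eddington_closure_poly power2_eq_square field_simps)
  \<comment> \<open>This is \<open>(1 - k) / 2 = 1/3 - (3 * k - 1) / 6\<close>.\<close>
  also have "((1 - k) / 2) *\<^sub>R e = (1/3) *\<^sub>R e - (closure_poly (norm u) / 5 * ((norm u)\<^sup>2 / 3)) *\<^sub>R e"
    unfolding scaleR_diff_left[symmetric] by (simp add: k_def eddington_closure_poly field_simps)
  also have "(1/3) *\<^sub>R e - (closure_poly (norm u) / 5 * ((norm u)\<^sup>2 / 3)) *\<^sub>R e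
      + (closure_poly (norm u) / 5 * (u \<bullet> e)) *\<^sub>R u = pressure e u"
    by (simp add: pressure_def traceless_def scaleR_diff_right)
  finally show ?thesis
    by (simp add: u_def y_def)
qed

text \<open>The division by \<open>lorentz v\<close> cancels the factor \<open>W\<close> of the
  unknowns, and the choice \<open>1 / (1 + s)\<close> of the relaxation parameter leaves the old
  iterate with weight \<open>s / (1 + s)\<close>.\<close>

lemma moment_step_stretch:
  assumes J: "0 < J"
    and J': "J' = J - 1 / (1 + s) / lorentz v *
      (lorentz v * J + (\<Sum>i\<in>UNIV. v $ i * H $ i) - E)"
    and H': "\<And>j. H' $ j = H $ j - 1 / (1 + s) / lorentz v *
      (lorentz v * H $ j + (\<Sum>i\<in>UNIV. v $ i * closureK v J H $ i $ j) - F $ j)"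
  shows "(J', stretch e r H')
    = moment_step e s (r * E, r *\<^sub>R stretch e r F) (J, stretch e r H)"
proof -
  let ?T = "stretch e r" and ?w = "\<chi> j. \<Sum>i\<in>UNIV. v $ i * closureK v J H $ i $ j"
  interpret T: linear ?T
    by (rule linear_stretch)
  have "(\<Sum>i\<in>UNIV. v $ i * H $ i) = s / r * (?T H \<bullet> e)"
    using inner_v[of H] by (simp add: inner_vec_def)
  then have "J' = J - 1 / (1 + s) / (1 / r) * (1 / r * J + s / r * (?T H \<bullet> e) - E)"
    by (simp only: J' lorentz_eq)
  also have "\<dots> = J - (J + s * (?T H \<bullet> e) - r * E) / (1 + s)"
    using r_pos by (simp add: right_diff_distrib distrib_left diff_divide_distrib add_divide_distrib)
  also have "\<dots> = (s * (J - ?T H \<bullet> e) + r * E) / (1 + s)"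
    using s by (simp add: field_simps)
  finally have J'_eq: "J' = (s * (J - ?T H \<bullet> e) + r * E) / (1 + s)" .
  have "H' = H - (r / (1 + s)) *\<^sub>R ((1 / r) *\<^sub>R H + ?w - F)"
    by (simp add: vec_eq_iff H' lorentz_eq)
  then have "?T H' = ?T H - (r / (1 + s)) *\<^sub>R ((1 / r) *\<^sub>R ?T H + ?T ?w - ?T F)"
    by (simp add: T.diff T.scale T.add)
  then have "?T H' = ?T H - ((1 / (1 + s)) *\<^sub>R ?T H
      + (s / (1 + s)) *\<^sub>R J *\<^sub>R pressure e (?T H /\<^sub>R J) - (r / (1 + s)) *\<^sub>R ?T F)"
    using r_pos by (simp add: stretch_closure[OF J] scaleR_add_right scaleR_diff_right)
  also have "\<dots> = (1 - 1 / (1 + s)) *\<^sub>R ?T H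
      - (s / (1 + s)) *\<^sub>R J *\<^sub>R pressure e (?T H /\<^sub>R J) + (r / (1 + s)) *\<^sub>R ?T F"
    by (simp add: algebra_simps)
  also have "1 - 1 / (1 + s) = s / (1 + s)"
    using s by (simp add: field_simps)
  finally have "?T H' = (1 / (1 + s)) *\<^sub>R
      (s *\<^sub>R (?T H - J *\<^sub>R pressure e (?T H /\<^sub>R J)) + r *\<^sub>R ?T F)"
    by (simp add: scaleR_add_right scaleR_diff_right)
  then show ?thesis
    by (simp add: moment_step_def J'_eq)
qed

text \<open>The update subtracts a nonzero multiple of the residuals, and \<open>stretch e r\<close>
  is injective.\<close>

lemma solves_iff_fixed_point:
  assumes J: "0 < J"
  shows "solves v E F J H \<longleftrightarrow>
    moment_step e s (r * E, r *\<^sub>R stretch e r F) (J, stretch e r H) = (J, stretch e r H)"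
proof -
  let ?R = "lorentz v * J + (\<Sum>i\<in>UNIV. v $ i * H $ i) - E"
  let ?Q = "\<lambda>j. lorentz v * H $ j + (\<Sum>i\<in>UNIV. v $ i * closureK v J H $ i $ j) - F $ j"
  let ?c = "1 / (1 + s) / lorentz v"
  define H' where "H' = (\<chi> j. H $ j - ?c * ?Q j)"
  have c: "?c \<noteq> 0"
    using s r_pos by (simp add: lorentz_eq)
  have step: "moment_step e s (r * E, r *\<^sub>R stretch e r F) (J, stretch e r H)
      = (J - ?c * ?R, stretch e r H')"
    by (rule moment_step_stretch[OF J refl, symmetric]) (simp add: H'_def)
  have "stretch e r H' = stretch e r H \<longleftrightarrow> H' = H"
    using r_pos by (metis stretch_inverse[OF e] less_irrefl)
  moreover have "H' = H \<longleftrightarrow> (\<forall>j. ?Q j = 0)"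
    unfolding H'_def vec_eq_iff using c by simp
  moreover have "J - ?c * ?R = J \<longleftrightarrow> ?R = 0"
    using c by simp
  moreover have "solves v E F J H \<longleftrightarrow> ?R = 0 \<and> (\<forall>j. ?Q j = 0)"
    by (auto simp: solves_def)
  ultimately show ?thesis
    unfolding step prod.inject by blast
qed

end

section \<open>Transfer back to the original variables\<close>

theorem mainTheorem6:
  fixes v F :: "real^3" and E lam :: real
    and J :: "nat \<Rightarrow> real" and H :: "nat \<Rightarrow> real^3"
  assumes v: "norm v < 0.221075"
    and U: "realizable v E F"
    and lam: "lam = 1 / (1 + norm v)"
    and J_0: "J 0 = E / lorentz v"
    and H_0: "\<And>j. H 0 $ j = F $ j / lorentz v"
    and J_Suc: "\<And>k. J (Suc k) = J k - lam / lorentz v *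
           (lorentz v * J k + (\<Sum>i\<in>UNIV. v $ i * H k $ i) - E)"
    and H_Suc: "\<And>k j. H (Suc k) $ j = H k $ j - lam / lorentz v *
           (lorentz v * H k $ j + (\<Sum>i\<in>UNIV. v $ i * closureK v (J k) (H k) $ i $ j) - F $ j)"
  shows "\<exists>J' H'. realizable v J' H' \<and> solves v E F J' H'
           \<and> (\<forall>J'' H''. realizable v J'' H'' \<and> solves v E F J'' H'' \<longrightarrow> J'' = J' \<and> H'' = H')
           \<and> J \<longlonglongrightarrow> J' \<and> H \<longlonglongrightarrow> H'"
proof -
  define s where "s = norm v"
  \<comment> \<open>At rest any unit vector serves as the direction of \<open>v\<close>.\<close>
  have "\<exists>e. norm e = 1 \<and> v = s *\<^sub>R e"
  proof (cases "v = 0")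
    case True
    then show ?thesis
      using vector_choose_size[of 1, where 'a = "real^3"] by (auto simp: s_def)
  next
    case False
    then show ?thesis
      by (intro exI[of _ "v /\<^sub>R s"]) (simp add: s_def)
  qed
  then obtain e where e: "norm e = 1" and ve: "v = s *\<^sub>R e"
    by blast
  define r where "r = sqrt (1 - s\<^sup>2)"
  have s: "0 \<le> s" "s < 0.221075" "s < 1"
    using v by (simp_all add: s_def)
  note frame = e ve s(1,3) r_def
  let ?T = "stretch e r" and ?T' = "stretch e (1 / r)"
  interpret T: linear ?T
    by (rule linear_stretch)
  have r: "0 < r"
    by (rule r_pos[OF frame])
  have T'T: "?T' (?T b) = b" for b
    using r by (simp add: stretch_inverse[OF e])
  have TT': "?T (?T' b) = b" for b
    using r stretch_inverse[OF e, of "1 / r" b] by simp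
  have realizable_iff: "realizable v a b \<longleftrightarrow> 0 < a \<and> norm (?T b) \<le> a" for a b
    by (simp add: realizable_def cov_norm_eq[OF frame])
  define x where "x k = (J k, ?T (H k))" for k
  define b where "b = (r * E, r *\<^sub>R ?T F)"
  have b: "0 < fst b" "norm (snd b) \<le> fst b"
    using U r by (simp_all add: b_def realizable_iff)
  have "H 0 = r *\<^sub>R F"
    by (simp add: vec_eq_iff H_0 lorentz_eq[OF frame])
  \<comment> \<open>The initial guess, the data divided by \<open>W\<close>, is exactly the
    inhomogeneity of the iteration.\<close>
  then have x0: "x 0 = b"
    by (simp add: x_def b_def J_0 lorentz_eq[OF frame] T.scale)
  \<comment> \<open>The closure is rewritten only for positive \<open>J k\<close>; that this
    persists along the iteration comes from the invariance of the cone.\<close>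
  have xSuc: "x (Suc k) = moment_step e s b (x k)" if "0 < fst (x k)" for k
    unfolding x_def b_def using that J_Suc H_Suc
    by (intro moment_step_stretch[OF frame]) (simp_all add: x_def lam s_def)
  obtain p where p: "0 < fst p" "norm (snd p) \<le> fst p" "moment_step e s b p = p" "x \<longlonglongrightarrow> p"
    and unique: "\<And>q. 0 < fst q \<Longrightarrow> norm (snd q) \<le> fst q \<Longrightarrow> moment_step e s b q = q \<Longrightarrow> q = p"
    using moment_iterates_converge[OF e s(1,2) b x0 xSuc] by blast
  have solves_iff: "solves v E F a c \<longleftrightarrow> moment_step e s b (a, ?T c) = (a, ?T c)" if "0 < a" for a c
    unfolding b_def by (rule solves_iff_fixed_point[OF frame that])
  have "J \<longlonglongrightarrow> fst p"
    using tendsto_fst[OF p(4)] by (simp add: x_def)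
  moreover have "H \<longlonglongrightarrow> ?T' (snd p)"
    using bounded_linear.tendsto[OF bounded_linear_stretch tendsto_snd[OF p(4)], of e "1 / r"]
    by (simp add: x_def T'T)
  moreover have "realizable v (fst p) (?T' (snd p))" "solves v E F (fst p) (?T' (snd p))"
    using p by (simp_all add: realizable_iff solves_iff TT')
  moreover have "a = fst p \<and> c = ?T' (snd p)" if "realizable v a c" "solves v E F a c" for a c
  proof -
    have "(a, ?T c) = p"
      using that by (intro unique) (simp_all add: realizable_iff solves_iff)
    then show ?thesis
      using T'T by force
  qed
  ultimately show ?thesis
    by blast
qed

end
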